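(* Let $0<\alpha<1$, $X>0$, $D>0$, let $n\ge 2$ be an integer, $h=X/n$ and $x_m=mh$. Let $y$ be the solution on $[0,X]$ of the fractional relaxation equation $y^{(\alpha)}(x)+Dy(x)=F(x)$, $y(0)=y_0$, and write $y_m=y(x_m)$, $F_m=F(x_m)$. Let $\lambda_0>0$, $L>0$ and, for each $1\le m\le n$, let $\lambda_1^{(m)},\dots,\lambda_m^{(m)}$ be positive numbers with $$\sum_{k=1}^m\lambda_k^{(m)}=\lambda_0,\qquad 0<\frac{L}{m^\alpha}<\lambda_m^{(m)}.$$ For $2\le m\le n$ let $E_m$ be defined by $$\frac{1}{h^\alpha}\Big(\lambda_0y_m-\sum_{k=1}^m\lambda_k^{(m)}y_{m-k}\Big)-y^{(\alpha)}(x_m)=E_mh^{2-\alpha},$$ and let $E>0$ satisfy $|E_m|<E$ for $m=2,\dots,n$. Let $u_0,\dots,u_n$ be the numerical solution $$u_0=y_0,\qquad u_1=\frac{y_0+\Gamma(2-\alpha)h^\alpha F(h)}{1+\Gamma(2-\alpha)Dh^\alpha},\qquad u_m=\frac{1}{\lambda_0+Dh^\alpha}\Big(h^\alpha F_m+\sum_{k=1}^m\lambda_k^{(m)}u_{m-k}\Big)\quad(2\le m\le n),$$ and let $e_m=u_m-y_m$. Let $A>2E/\lambda_0$ be a positive number such that $|e_1|<Ah^{2-\alpha}$, and let $$C>\max\left\{A,\frac{A(\lambda_0+D)}{D}\right\}.$$ Then $|e_m|<Ch^{2-\alpha}$ for all $m=1,\dots,n$.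
   Context: For $0<\alpha<1$ the Caputo derivative is $y^{(\alpha)}(x)=\frac{1}{\Gamma(1-\alpha)}\int_0^x\frac{y'(t)}{(x-t)^\alpha}\,dt$. The solution $y$ is assumed continuously differentiable on $[0,X]$ so that its Caputo derivative is defined at every grid point. *)

theory Defs
  imports "HOL-Analysis.Analysis"
begin

text \<open>
  Differentiability is taken within \<open>{a..b}\<close>, so it is one-sided at the endpoints and
  only the values of \<open>f\<close> on \<open>{a..b}\<close> matter; this is weaker than
  \<open>f C1_differentiable_on {a..b}\<close>, which uses two-sided derivatives at \<open>a\<close> and \<open>b\<close>.
\<close>
definition continuously_differentiable_on_interval ::
    "(real \<Rightarrow> real) \<Rightarrow> real \<Rightarrow> real \<Rightarrow> bool" where
  "continuously_differentiable_on_interval f a b \<longleftrightarrow>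
     (\<exists>f'. (\<forall>t\<in>{a..b}. (f has_real_derivative f' t) (at t within {a..b})) \<and>
           continuous_on {a..b} f')"

text \<open>
  The derivative within \<open>{0..x}\<close> is the ordinary one for \<open>0 < t < x\<close>, so \<open>caputo \<alpha> y x\<close>
  depends only on \<open>y\<close> restricted to \<open>{0..x}\<close>. At \<open>t = x\<close> the integrand is \<open>0\<close> by the
  convention for division by zero, which does not affect the integral.
\<close>
definition caputo :: "real \<Rightarrow> (real \<Rightarrow> real) \<Rightarrow> real \<Rightarrow> real" where
  "caputo \<alpha> y x =
     1 / Gamma (1 - \<alpha>) *
     integral {0..x} (\<lambda>t. vector_derivative y (at t within {0..x}) / (x - t) powr \<alpha>)"

end

theory Submission
  imports Defs
begin

text \<open>
  Subtracting the equation for the exact solution from the scheme shows that, for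
  \<open>m \<ge> 2\<close>, the error satisfies
  \<open>(lam0 + D h\<^sup>\<alpha>) e\<^sub>m = (\<Sum>k=1..m. lam m k * e\<^bsub>m-k\<^esub>) - Em m * h\<^sup>2\<close>:
  the truncation error of order \<open>2 - \<alpha>\<close> gains a factor \<open>h\<^sup>\<alpha>\<close> when the scheme is solved
  for its newest value (lemma \<open>error_recursion\<close>).

  The weights are nonnegative with sum \<open>lam0\<close>, so the sum on the right is \<open>lam0\<close> times an
  average of earlier errors and cannot exceed \<open>lam0\<close> times a common bound for them. The
  damping term \<open>D h\<^sup>\<alpha>\<close> on the left leaves room for the source: a bound \<open>B\<close> on all earlier
  errors passes to the next one as soon as \<open>\<bar>Em m\<bar> h\<^sup>2 < D h\<^sup>\<alpha> B\<close>
  (lemma \<open>damped_average_bound\<close>). With \<open>B = C h\<^bsup>2-\<alpha>\<^esup>\<close> this condition is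
  \<open>\<bar>Em m\<bar> < D C\<close>, in which the step size has cancelled, so that the bound does not deteriorate
  from one step to the next. It holds because
  \<open>D C > A (lam0 + D) > A lam0 > 2 E\<close>. The recursion is started by \<open>e 0 = 0\<close> and the
  assumed bound on \<open>e 1\<close>.
\<close>

lemma error_recursion:
  fixes a b D F c l t :: real and w v y :: "nat \<Rightarrow> real"
  assumes "0 < a" and "0 < l + D * a"
    and equation: "c + D * y m = F"
    and truncation: "1 / a * (l * y m - (\<Sum>k\<in>K. w k * y (m - k))) - c = t * b"
    and scheme: "v m = 1 / (l + D * a) * (a * F + (\<Sum>k\<in>K. w k * v (m - k)))"
  shows "(l + D * a) * (v m - y m) = (\<Sum>k\<in>K. w k * (v (m - k) - y (m - k))) - t * (a * b)"
proof -
  have "l * y m - (\<Sum>k\<in>K. w k * y (m - k)) = a * (c + t * b)"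
    using truncation \<open>0 < a\<close> by (simp add: field_simps)
  moreover have "(l + D * a) * v m = a * F + (\<Sum>k\<in>K. w k * v (m - k))"
    using scheme \<open>0 < l + D * a\<close> by simp
  ultimately show ?thesis
    unfolding equation[symmetric] by (simp add: algebra_simps sum_subtractf)
qed

text \<open>
  A discrete maximum principle: the triangle inequality bounds the sum by \<open>l * B\<close>, and the
  strict bound on the source then gives \<open>(l + d) * \<bar>z\<bar> < (l + d) * B\<close>. The earlier values
  are bounded only weakly, so that a vanishing initial error is admitted on the same footing
  as the others.
\<close>
lemma damped_average_bound:
  fixes w v :: "'i \<Rightarrow> real" and d l s z B :: real
  assumes "0 < l + d"
    and "\<And>k. k \<in> K \<Longrightarrow> 0 \<le> w k" and "(\<Sum>k\<in>K. w k) = l"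
    and "\<And>k. k \<in> K \<Longrightarrow> \<bar>v k\<bar> \<le> B"
    and "(l + d) * z = (\<Sum>k\<in>K. w k * v k) - s" and "\<bar>s\<bar> < d * B"
  shows "\<bar>z\<bar> < B"
proof -
  have "\<bar>\<Sum>k\<in>K. w k * v k\<bar> \<le> (\<Sum>k\<in>K. \<bar>w k * v k\<bar>)"
    by (rule sum_abs)
  also have "\<dots> \<le> (\<Sum>k\<in>K. w k * B)"
    using assms(2,4) by (intro sum_mono) (simp add: abs_mult mult_left_mono)
  also have "\<dots> = l * B"
    using assms(3) by (simp flip: sum_distrib_right)
  finally have "\<bar>(l + d) * z\<bar> < (l + d) * B"
    using assms(5,6) by (simp add: distrib_right)
  then show ?thesis
    using \<open>0 < l + d\<close> by (simp add: abs_mult)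
qed

theorem theorem9:
  fixes \<alpha> X D h y0 lam0 L E A C :: real
    and n :: nat
    and F y :: "real \<Rightarrow> real"
    and x Em u e :: "nat \<Rightarrow> real"
    and lam :: "nat \<Rightarrow> nat \<Rightarrow> real"
  assumes "0 < \<alpha>" and "\<alpha> < 1" and "0 < X" and "0 < D" and "2 \<le> n"
    and "h = X / real n"
    and "\<And>m. m \<le> n \<Longrightarrow> x m = real m * h"
    and "continuously_differentiable_on_interval y 0 X"
    and "\<And>t. t \<in> {0..X} \<Longrightarrow> caputo \<alpha> y t + D * y t = F t"
    and "y 0 = y0"
    and "0 < lam0" and "0 < L"
    and "\<And>m k. 1 \<le> m \<Longrightarrow> m \<le> n \<Longrightarrow> 1 \<le> k \<Longrightarrow> k \<le> m \<Longrightarrow> 0 < lam m k"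
    and "\<And>m. 1 \<le> m \<Longrightarrow> m \<le> n \<Longrightarrow> (\<Sum>k=1..m. lam m k) = lam0"
    and "\<And>m. 1 \<le> m \<Longrightarrow> m \<le> n \<Longrightarrow>
           0 < L / real m powr \<alpha> \<and> L / real m powr \<alpha> < lam m m"
    and "\<And>m. 2 \<le> m \<Longrightarrow> m \<le> n \<Longrightarrow>
           1 / h powr \<alpha> * (lam0 * y (x m) - (\<Sum>k=1..m. lam m k * y (x (m - k))))
             - caputo \<alpha> y (x m) = Em m * h powr (2 - \<alpha>)"
    and "0 < E"
    and "\<And>m. 2 \<le> m \<Longrightarrow> m \<le> n \<Longrightarrow> \<bar>Em m\<bar> < E"
    and "u 0 = y0"
    and "u 1 = (y0 + Gamma (2 - \<alpha>) * h powr \<alpha> * F h) / (1 + Gamma (2 - \<alpha>) * D * h powr \<alpha>)"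
    and "\<And>m. 2 \<le> m \<Longrightarrow> m \<le> n \<Longrightarrow>
           u m = 1 / (lam0 + D * h powr \<alpha>)
                   * (h powr \<alpha> * F (x m) + (\<Sum>k=1..m. lam m k * u (m - k)))"
    and "\<And>m. m \<le> n \<Longrightarrow> e m = u m - y (x m)"
    and "0 < A" and "2 * E / lam0 < A"
    and "\<bar>e 1\<bar> < A * h powr (2 - \<alpha>)"
    and "max A (A * (lam0 + D) / D) < C"
  shows "\<forall>m\<in>{1..n}. \<bar>e m\<bar> < C * h powr (2 - \<alpha>)"
proof -
  define H where "H = h powr (2 - \<alpha>)"
  define a where "a = h powr \<alpha>"
  have h: "0 < h" using assms(3,5,6) by simp
  then have a: "0 < a" and H: "0 < H" by (simp_all add: a_def H_def)
  have D: "0 < lam0 + D * a" using assms(4,11) a by (simp add: add_pos_pos)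
  have AC: "A < C" and "A * (lam0 + D) / D < C"
    using assms(26) by simp_all
  then have "A * lam0 + A * D < D * C"
    using assms(4) by (simp add: field_simps)
  moreover have "2 * E < A * lam0"
    using assms(11,24) by (simp add: field_simps)
  moreover have "0 < A * D" using assms(4,23) by simp
  ultimately have EDC: "E < D * C" using assms(17) by linarith
  have C: "0 < C * H" using AC assms(23) H by simp
  have e0: "e 0 = 0" using assms(7)[of 0] assms(10,19,22) by simp
  have "\<bar>e m\<bar> < C * H" if "1 \<le> m" "m \<le> n" for m
    using that
  proof (induction m rule: less_induct)
    case (less m)
    show ?case
    proof (cases "m = 1")
      case True
      have "A * H < C * H" using AC H by simp
      then show ?thesis using assms(25) True by (simp add: H_def)
    next
      case False
      with less.prems have m: "2 \<le> m" "m \<le> n" by auto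
      have xX: "x m \<in> {0..X}"
      proof -
        have "X = real n * h" using assms(5,6) by simp
        then show ?thesis using assms(7)[OF m(2)] m h by (simp add: mult_right_mono)
      qed
      show ?thesis
      proof (rule damped_average_bound[where l = lam0 and d = "D * a" and K = "{1..m}"
            and w = "lam m" and v = "\<lambda>k. e (m - k)" and s = "Em m * (a * H)"])
        show "0 \<le> lam m k" if "k \<in> {1..m}" for k
          using assms(13)[of m k] that m by auto
        show "\<bar>e (m - k)\<bar> \<le> C * H" if "k \<in> {1..m}" for k
        proof (cases "k = m")
          case True
          then show ?thesis using e0 C by simp
        next
          case False
          then have "\<bar>e (m - k)\<bar> < C * H" using that m by (intro less.IH) auto
          then show ?thesis by simp
        qed
        have "(lam0 + D * a) * (u m - y (x m)) =
            (\<Sum>k=1..m. lam m k * (u (m - k) - y (x (m - k)))) - Em m * (a * H)"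
          using assms(9)[OF xX] assms(16,21)[OF m] unfolding a_def[symmetric] H_def[symmetric]
          by (rule error_recursion[where y = "\<lambda>j. y (x j)", OF a D])
        moreover have "(\<Sum>k=1..m. lam m k * e (m - k)) =
            (\<Sum>k=1..m. lam m k * (u (m - k) - y (x (m - k))))"
          using assms(22) m by simp
        ultimately show "(lam0 + D * a) * e m = (\<Sum>k=1..m. lam m k * e (m - k)) - Em m * (a * H)"
          using assms(22)[OF m(2)] by simp
        have "\<bar>Em m\<bar> * (a * H) < D * C * (a * H)"
          using assms(18)[OF m] EDC a H by (intro mult_strict_right_mono) auto
        then show "\<bar>Em m * (a * H)\<bar> < D * a * (C * H)"
          using a H by (simp add: abs_mult mult_ac)
      qed (use D assms(14)[of m] m in auto)
    qed
  qed
  then show ?thesis by (simp add: H_def)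
qed

end
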